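(* Let $\gamma:\mathbb{R}^d\to\mathbb{R}$ be a gauge and let $x\in\mathbb{R}^d$ be a non-zero vector. Then, for all $y\in\mathbb{R}^d$, the set of numbers $\alpha\in\mathbb{R}$ with $(\alpha x+y)\perp_I x$ is non-empty, closed, bounded, and convex, i.e., a compact interval.
   Context: A gauge is a function $\gamma:\mathbb{R}^d\to\mathbb{R}$ such that $\gamma(x)\geq 0$ for all $x$, $\gamma(x)=0$ implies $x=0$, $\gamma(\lambda x)=\lambda\gamma(x)$ for all $\lambda>0$, and $\gamma(x+y)\leq\gamma(x)+\gamma(y)$ (it need not be symmetric). A point $y\in\mathbb{R}^d$ is isosceles orthogonal to $x\in\mathbb{R}^d$, written $y\perp_I x$, if $\gamma(y+x)=\gamma(y-x)$. *)

theory Defs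
  imports "HOL-Analysis.Analysis"
begin

(* The name "gauge" is already used in HOL-Analysis for the unrelated notion from
   Henstock-Kurzweil integration. *)
definition gauge_function :: "(real ^ 'd \<Rightarrow> real) \<Rightarrow> bool" where
  "gauge_function \<gamma> \<longleftrightarrow>
     (\<forall>x. \<gamma> x \<ge> 0) \<and>
     (\<forall>x. \<gamma> x = 0 \<longrightarrow> x = 0) \<and>
     (\<forall>x l. l > 0 \<longrightarrow> \<gamma> (l *\<^sub>R x) = l * \<gamma> x) \<and>
     (\<forall>x y. \<gamma> (x + y) \<le> \<gamma> x + \<gamma> y)"

(* "isosceles_orthogonal \<gamma> y x" is y \<perp>\<^sub>I x; the order of arguments matters
   because \<gamma> need not be symmetric. *)
definition isosceles_orthogonal ::
    "(real ^ 'd \<Rightarrow> real) \<Rightarrow> real ^ 'd \<Rightarrow> real ^ 'd \<Rightarrow> bool" where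
  "isosceles_orthogonal \<gamma> y x \<longleftrightarrow> \<gamma> (y + x) = \<gamma> (y - x)"

end

theory Submission
  imports Defs
begin

text \<open>
  The restriction f of \<open>\<gamma>\<close> to the line through y in direction x is convex and tends to infinity
  at both ends. By convexity the increment \<open>h t = f (t + 1) - f (t - 1)\<close> is nondecreasing, and it
  is continuous. If h had constant (weak) sign, f would stay bounded along an arithmetic
  progression tending to infinity or to minus infinity, so h takes both strict signs. Hence the
  zero set of h, which is the set of \<open>\<alpha>\<close> in question, is a nonempty compact interval.
\<close>

text \<open>Both \<open>s + p\<close> and \<open>t\<close> lie between \<open>s\<close> and
  \<open>t + p\<close>, as convex combinations with the weights \<open>w\<close> and
  \<open>1 - w\<close> interchanged. Adding the two convexity inequalities makes the weights sum to
  1.\<close>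

lemma convex_on_increment_mono:
  fixes f :: "real \<Rightarrow> real"
  assumes conv: "convex_on UNIV f" and "0 < p" "s \<le> t"
  shows "f (s + p) - f s \<le> f (t + p) - f t"
proof -
  define w where "w = p / (t + p - s)"
  have w: "0 \<le> w" "w \<le> 1"
    using assms by (auto simp: w_def)
  have wp: "w * (t + p - s) = p"
    using assms by (simp add: w_def)
  have combine: "f ((1 - v) * s + v * (t + p)) \<le> (1 - v) * f s + v * f (t + p)"
    if "0 \<le> v" "v \<le> 1" for v
    using convex_onD[OF conv that, of s "t + p"] by simp
  have "(1 - w) * s + w * (t + p) = s + p" and "w * s + (1 - w) * (t + p) = t"
    using wp by (simp_all add: algebra_simps)
  then have "f (s + p) \<le> (1 - w) * f s + w * f (t + p)"
    and "f t \<le> w * f s + (1 - w) * f (t + p)"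
    using combine[OF w] combine[of "1 - w"] w by simp_all
  then have "f (s + p) + f t \<le> f s + f (t + p)"
    by (simp add: algebra_simps)
  then show ?thesis
    by simp
qed

lemma exists_increment_pos:
  fixes f :: "real \<Rightarrow> real"
  assumes lim: "filterlim f at_top at_top" and "0 < p"
  obtains t where "f t < f (t + p)"
proof -
  have "\<exists>t. f t < f (t + p)"
  proof (rule ccontr)
    assume "\<nexists>t. f t < f (t + p)"
    then have desc: "f (t + p) \<le> f t" for t
      by (meson not_less)
    \<comment> \<open>Without a strict increase over any step of length \<open>p\<close>, the values
      at 0, \<open>p\<close>, \<open>2 * p\<close>, ... never exceed the first one, which
      contradicts divergence.\<close>
    have bound: "f (real n * p) \<le> f 0" for n
    proof (induction n)
      case (Suc n)
      then show ?case
        using desc[of "real n * p"] by (simp add: algebra_simps)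
    qed simp
    have "filterlim (\<lambda>n. real n * p) at_top sequentially"
      by (rule filterlim_at_top_mult_tendsto_pos[OF tendsto_const \<open>0 < p\<close>
          filterlim_real_sequentially])
    then have "filterlim (\<lambda>n. f (real n * p)) at_top sequentially"
      by (rule filterlim_compose[OF lim])
    then have "\<forall>\<^sub>F n in sequentially. f 0 < f (real n * p)"
      unfolding filterlim_at_top_dense by blast
    then obtain n where "f 0 < f (real n * p)"
      using eventually_happens'[OF sequentially_bot] by blast
    with bound[of n] show False
      by simp
  qed
  then show thesis
    using that by blast
qed

lemma convex_coercive_equal_value_interval:
  fixes f :: "real \<Rightarrow> real"
  assumes conv: "convex_on UNIV f"
    and top: "filterlim f at_top at_top" and bot: "filterlim f at_top at_bot"
    and "0 < d"
  obtains a b where "a \<le> b" "{t. f (t + d) = f (t - d)} = {a..b}"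
proof -
  define h where "h t = f (t + d) - f (t - d)" for t
  \<comment> \<open>\<open>h s\<close> is the increment over the window of length
    \<open>2 * d\<close> centred at \<open>s\<close>, hence starting at
    \<open>s - d\<close>.\<close>
  have mono: "h s \<le> h t" if "s \<le> t" for s t
    using convex_on_increment_mono[OF conv, of "2 * d" "s - d" "t - d"] that \<open>0 < d\<close>
    by (simp add: h_def algebra_simps)
  have contf: "continuous_on UNIV f"
    using conv by (simp add: convex_on_continuous)
  have cont: "continuous_on A h" for A
    unfolding h_def
    by (intro continuous_on_diff continuous_on_compose2[OF contf, of _ "\<lambda>t. t + d"]
        continuous_on_compose2[OF contf, of _ "\<lambda>t. t - d"] continuous_intros) auto
  obtain t where "f t < f (t + 2 * d)"
    using exists_increment_pos[OF top, of "2 * d"] \<open>0 < d\<close> by auto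
  then have pos: "0 < h (t + d)"
    by (simp add: h_def algebra_simps)
  \<comment> \<open>Reflection turns the growth at minus infinity into growth at plus infinity; a
    strict increase of the reflected function is a strict decrease of \<open>f\<close>, over the
    window centred at \<open>- s - d\<close>.\<close>
  have "filterlim (\<lambda>t. f (- t)) at_top at_top"
    using filterlim_compose[OF bot filterlim_uminus_at_bot_at_top] .
  then obtain s where "f (- s) < f (- (s + 2 * d))"
    using exists_increment_pos[of "\<lambda>t. f (- t)" "2 * d"] \<open>0 < d\<close> by auto
  then have neg: "h (- s - d) < 0"
    by (simp add: h_def algebra_simps)
  define S where "S = {t. h t = 0}"
  \<comment> \<open>In the opposite order, monotonicity would put the positive value of
    \<open>h\<close> below the negative one.\<close>
  have le: "- s - d \<le> t + d"
    using mono[of "t + d" "- s - d"] pos neg by linarith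
  obtain u where "h u = 0"
    using IVT'[OF _ _ le cont, of 0] pos neg by auto
  then have "u \<in> S"
    by (simp add: S_def)
  have "S \<subseteq> {- s - d..t + d}"
  proof
    fix v assume "v \<in> S"
    then have "h v = 0"
      by (simp add: S_def)
    then have "\<not> v \<le> - s - d" "\<not> t + d \<le> v"
      using mono[of v "- s - d"] mono[of "t + d" v] pos neg by linarith+
    then show "v \<in> {- s - d..t + d}"
      by simp
  qed
  then have "bounded S"
    using bounded_closed_interval bounded_subset by blast
  moreover have "closed S"
    using continuous_closed_preimage[OF cont, of UNIV "{0}"] by (simp add: S_def vimage_def)
  ultimately have "compact S"
    by (simp add: compact_eq_bounded_closed)
  \<comment> \<open>Between two zeros the nondecreasing \<open>h\<close> is squeezed to 0.\<close>
  moreover have "is_interval S"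
    unfolding is_interval_1
  proof (intro ballI allI impI)
    fix v w r assume "v \<in> S" "w \<in> S" "v \<le> r \<and> r \<le> w"
    then show "r \<in> S"
      using mono[of v r] mono[of r w] by (simp add: S_def)
  qed
  ultimately obtain a b where S: "S = {a..b}"
    using connected_compact_interval_1 is_interval_connected_1 by blast
  with \<open>u \<in> S\<close> have "a \<le> b"
    by simp
  moreover have "{t. f (t + d) = f (t - d)} = {a..b}"
    using S by (simp add: S_def h_def)
  ultimately show thesis
    by (rule that)
qed

text \<open>The line is parametrised affinely, and subadditivity with positive homogeneity gives
  convexity; homogeneity is applied only to the positive weights \<open>1 - w\<close> and
  \<open>w\<close>.\<close>

lemma gauge_function_convex_on_line:
  assumes "gauge_function \<gamma>"
  shows "convex_on UNIV (\<lambda>t. \<gamma> (t *\<^sub>R x + y))"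
proof (intro convex_onI)
  fix w s t :: real
  assume w: "0 < w" "w < 1"
  have "((1 - w) * s + w * t) *\<^sub>R x + y = (1 - w) *\<^sub>R (s *\<^sub>R x + y) + w *\<^sub>R (t *\<^sub>R x + y)"
    by (simp add: algebra_simps)
  moreover have "\<gamma> ((1 - w) *\<^sub>R (s *\<^sub>R x + y) + w *\<^sub>R (t *\<^sub>R x + y))
      \<le> \<gamma> ((1 - w) *\<^sub>R (s *\<^sub>R x + y)) + \<gamma> (w *\<^sub>R (t *\<^sub>R x + y))"
    using assms unfolding gauge_function_def by blast
  moreover have "\<gamma> ((1 - w) *\<^sub>R (s *\<^sub>R x + y)) = (1 - w) * \<gamma> (s *\<^sub>R x + y)"
    and "\<gamma> (w *\<^sub>R (t *\<^sub>R x + y)) = w * \<gamma> (t *\<^sub>R x + y)"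
    using assms w unfolding gauge_function_def by simp_all
  ultimately show "\<gamma> (((1 - w) *\<^sub>R s + w *\<^sub>R t) *\<^sub>R x + y)
      \<le> (1 - w) * \<gamma> (s *\<^sub>R x + y) + w * \<gamma> (t *\<^sub>R x + y)"
    by simp
qed simp

text \<open>Writing \<open>t *\<^sub>R x\<close> as \<open>(t *\<^sub>R x + y) + (- y)\<close>, the
  triangle inequality gives a lower bound that is affine in \<open>t\<close> with slope
  \<open>\<gamma> x > 0\<close>. The constant involves \<open>\<gamma> (- y)\<close>, which may
  differ from \<open>\<gamma> y\<close>.\<close>

lemma gauge_function_ray_at_top:
  assumes g: "gauge_function \<gamma>" and "x \<noteq> 0"
  shows "filterlim (\<lambda>t. \<gamma> (t *\<^sub>R x + y)) at_top at_top"
proof (rule filterlim_at_top_mono)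
  have "0 < \<gamma> x"
    using assms unfolding gauge_function_def by (metis less_eq_real_def)
  then have "filterlim (\<lambda>t. t * \<gamma> x) at_top at_top"
    by (rule filterlim_at_top_mult_tendsto_pos[OF tendsto_const _ filterlim_ident])
  then show "filterlim (\<lambda>t. - \<gamma> (- y) + t * \<gamma> x) at_top at_top"
    by (intro filterlim_tendsto_add_at_top[OF tendsto_const])
  show "\<forall>\<^sub>F t in at_top. - \<gamma> (- y) + t * \<gamma> x \<le> \<gamma> (t *\<^sub>R x + y)"
  proof (rule eventually_mono[OF eventually_gt_at_top[of 0]])
    fix t :: real assume "0 < t"
    moreover have "\<gamma> ((t *\<^sub>R x + y) + (- y)) \<le> \<gamma> (t *\<^sub>R x + y) + \<gamma> (- y)"
      using g unfolding gauge_function_def by blast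
    ultimately show "- \<gamma> (- y) + t * \<gamma> x \<le> \<gamma> (t *\<^sub>R x + y)"
      using g unfolding gauge_function_def by simp
  qed
qed

theorem lemma4p4:
  fixes \<gamma> :: "real ^ 'd \<Rightarrow> real" and x :: "real ^ 'd"
  assumes "gauge_function \<gamma>" and "x \<noteq> 0"
  shows "\<forall>y :: real ^ 'd.
    {\<alpha>::real. isosceles_orthogonal \<gamma> (\<alpha> *\<^sub>R x + y) x} \<noteq> {} \<and>
    closed {\<alpha>::real. isosceles_orthogonal \<gamma> (\<alpha> *\<^sub>R x + y) x} \<and>
    bounded {\<alpha>::real. isosceles_orthogonal \<gamma> (\<alpha> *\<^sub>R x + y) x} \<and>
    convex {\<alpha>::real. isosceles_orthogonal \<gamma> (\<alpha> *\<^sub>R x + y) x} \<and>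
    (\<exists>a b. a \<le> b \<and> {\<alpha>::real. isosceles_orthogonal \<gamma> (\<alpha> *\<^sub>R x + y) x} = {a..b})"
proof
  fix y :: "real ^ 'd"
  define f where "f t = \<gamma> (t *\<^sub>R x + y)" for t
  \<comment> \<open>The other end of the line is the ray in direction \<open>- x\<close>, so no
    symmetry of \<open>\<gamma>\<close> is used.\<close>
  have "filterlim (\<lambda>t. f (- t)) at_top at_top"
    using gauge_function_ray_at_top[OF assms(1), of "- x" y] assms(2) by (simp add: f_def)
  then have bot: "filterlim f at_top at_bot"
    by (simp add: filterlim_at_bot_mirror)
  have top: "filterlim f at_top at_top"
    unfolding f_def by (rule gauge_function_ray_at_top[OF assms])
  have conv: "convex_on UNIV f"
    unfolding f_def by (rule gauge_function_convex_on_line[OF assms(1)])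
  \<comment> \<open>Adding or subtracting \<open>x\<close> shifts the parameter by 1, whence
    \<open>d = 1\<close> below.\<close>
  have "{\<alpha>. isosceles_orthogonal \<gamma> (\<alpha> *\<^sub>R x + y) x} = {t. f (t + 1) = f (t - 1)}"
    by (simp add: isosceles_orthogonal_def f_def algebra_simps)
  moreover obtain a b where "a \<le> b" "{t. f (t + 1) = f (t - 1)} = {a..b}"
    using convex_coercive_equal_value_interval[OF conv top bot, of 1] by auto
  ultimately show "{\<alpha>. isosceles_orthogonal \<gamma> (\<alpha> *\<^sub>R x + y) x} \<noteq> {} \<and>
    closed {\<alpha>. isosceles_orthogonal \<gamma> (\<alpha> *\<^sub>R x + y) x} \<and>
    bounded {\<alpha>. isosceles_orthogonal \<gamma> (\<alpha> *\<^sub>R x + y) x} \<and>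
    convex {\<alpha>. isosceles_orthogonal \<gamma> (\<alpha> *\<^sub>R x + y) x} \<and>
    (\<exists>a b. a \<le> b \<and> {\<alpha>. isosceles_orthogonal \<gamma> (\<alpha> *\<^sub>R x + y) x} = {a..b})"
    by auto
qed

end
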